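(* For $n\geq 2$, let $\mathrm{Dic}_n=\langle a,b,c\mid a^n=b^2=c^2=abc\rangle$ be the dicyclic group of order $4n$. Then Player 1 has a winning strategy for $\texttt{RAV}(\mathrm{Dic}_n,\{a,b,c\})$.
   Context: This presentation is isomorphic to $\langle a,x\mid a^{2n}=e,\ x^2=a^n,\ x^{-1}ax=a^{-1}\rangle$ via $a\mapsto a$, $b\mapsto x^{-1}$, $c\mapsto ax^{-1}$. Game $\texttt{RAV}(G,S)$: $G$ is a finite group and $S$ a generating set with $e\notin S$. Two players alternate turns, Player 1 first, starting from the empty word $w_0$. On turn $n$ the current player chooses $s_n\in S\cup S^{-1}$, subject to $s_n\neq s_{n-1}^{-1}$ when $n>1$, and forms $w_n=w_{n-1}s_n$. If $w_n$ represents the same element of $G$ as some $w_k$ with $0\le k<n$, the player who formed $w_n$ loses. If a player has no legal move, that player loses. *)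

theory Defs imports "HOL-Algebra.Algebra" begin

section \<open>Groups given by generators and relations\<close>

text \<open>A letter \<open>(x, True)\<close> stands for the generator \<open>x\<close> and \<open>(x, False)\<close> for its formal inverse.
  All elements of the type \<open>'g\<close> are generators. A pair \<open>(u, v)\<close> in \<open>R\<close> is the relation \<open>u = v\<close>.\<close>

type_synonym 'g word = "('g \<times> bool) list"

inductive pres_eq :: "('g word \<times> 'g word) set \<Rightarrow> 'g word \<Rightarrow> 'g word \<Rightarrow> bool" for R where
  refl: "pres_eq R u u"
| sym: "pres_eq R u v \<Longrightarrow> pres_eq R v u"
| trans: "pres_eq R u v \<Longrightarrow> pres_eq R v w \<Longrightarrow> pres_eq R u w"
| append: "pres_eq R u u' \<Longrightarrow> pres_eq R v v' \<Longrightarrow> pres_eq R (u @ v) (u' @ v')"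
| cancel: "pres_eq R [(x, s), (x, \<not> s)] []"
| rel: "(u, v) \<in> R \<Longrightarrow> pres_eq R u v"

definition pres_rel :: "('g word \<times> 'g word) set \<Rightarrow> ('g word \<times> 'g word) set" where
  "pres_rel R = {(u, v). pres_eq R u v}"

definition presented_group :: "('g word \<times> 'g word) set \<Rightarrow> 'g word set monoid" where
  "presented_group R =
    \<lparr>carrier = UNIV // pres_rel R,
     monoid.mult = (\<lambda>A B. \<Union>u\<in>A. \<Union>v\<in>B. pres_rel R `` {u @ v}),
     monoid.one = pres_rel R `` {[]}\<rparr>"

definition pres_gen :: "('g word \<times> 'g word) set \<Rightarrow> 'g \<Rightarrow> 'g word set" where
  "pres_gen R x = pres_rel R `` {[(x, True)]}"

lemma equiv_pres_rel: "equiv UNIV (pres_rel R)"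
  unfolding pres_rel_def
  by (intro equivI refl_onI symI transI) (auto intro: pres_eq.intros)

lemma pres_class_eq_iff: "pres_rel R `` {u} = pres_rel R `` {v} \<longleftrightarrow> pres_eq R u v"
  using eq_equiv_class_iff[OF equiv_pres_rel, of u v R] by (auto simp: pres_rel_def)

lemma pres_class_in_carrier [simp]: "pres_rel R `` {u} \<in> carrier (presented_group R)"
  by (simp add: presented_group_def quotientI)

lemma pres_carrierE:
  assumes "A \<in> carrier (presented_group R)"
  obtains u where "A = pres_rel R `` {u}"
  using assms by (auto simp: presented_group_def elim: quotientE)

lemma pres_mult_class:
  "pres_rel R `` {u} \<otimes>\<^bsub>presented_group R\<^esub> pres_rel R `` {v} = pres_rel R `` {u @ v}"
proof -
  have "congruent2 (pres_rel R) (pres_rel R) (\<lambda>u v. pres_rel R `` {u @ v})"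
    by (intro congruent2I') (simp add: pres_class_eq_iff, simp add: pres_rel_def pres_eq.append)
  from UN_equiv_class2[OF equiv_pres_rel equiv_pres_rel this] show ?thesis
    by (simp add: presented_group_def)
qed

lemma pres_one_class: "\<one>\<^bsub>presented_group R\<^esub> = pres_rel R `` {[]}"
  by (simp add: presented_group_def)

definition inv_word :: "'g word \<Rightarrow> 'g word" where
  "inv_word u = rev (map (\<lambda>(x, s). (x, \<not> s)) u)"

lemma pres_eq_inv_word: "pres_eq R (inv_word u @ u) []"
proof (induction u)
  case Nil
  then show ?case by (simp add: inv_word_def pres_eq.refl)
next
  case (Cons l u)
  obtain x s where l: "l = (x, s)" by force
  have 1: "pres_eq R [(x, \<not> s), (x, s)] []" using pres_eq.cancel[of R x "\<not> s"] by simp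
  have "pres_eq R (inv_word u @ ([(x, \<not> s), (x, s)] @ u)) (inv_word u @ ([] @ u))"
    by (intro pres_eq.append pres_eq.refl 1)
  then have "pres_eq R (inv_word (l # u) @ l # u) (inv_word u @ u)"
    by (simp add: inv_word_def l)
  then show ?case using Cons pres_eq.trans by blast
qed

lemma group_presented_group: "group (presented_group R)"
proof (rule groupI)
  fix A assume "A \<in> carrier (presented_group R)"
  then obtain u where u: "A = pres_rel R `` {u}" by (rule pres_carrierE)
  show "\<exists>B\<in>carrier (presented_group R). B \<otimes>\<^bsub>presented_group R\<^esub> A = \<one>\<^bsub>presented_group R\<^esub>"
    by (rule bexI[of _ "pres_rel R `` {inv_word u}"])
      (simp_all add: u pres_mult_class pres_one_class pres_class_eq_iff pres_eq_inv_word)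
qed (auto elim!: pres_carrierE simp: pres_mult_class pres_one_class)

lemma pres_inv_gen:
  "inv\<^bsub>presented_group R\<^esub> (pres_gen R x) = pres_rel R `` {[(x, False)]}"
proof -
  interpret group "presented_group R" by (rule group_presented_group)
  have "pres_rel R `` {[(x, False)]} \<otimes>\<^bsub>presented_group R\<^esub> pres_gen R x
      = \<one>\<^bsub>presented_group R\<^esub>"
    using pres_eq.cancel[of R x False]
    by (simp add: pres_gen_def pres_mult_class pres_one_class pres_class_eq_iff)
  then show ?thesis by (intro inv_equality) (simp_all add: pres_gen_def)
qed

lemma pres_gen_closed [simp]: "pres_gen R x \<in> carrier (presented_group R)"
  by (simp add: pres_gen_def)

lemma generate_presented_group:
  "generate (presented_group R) (range (pres_gen R)) = carrier (presented_group R)"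
proof
  interpret group "presented_group R" by (rule group_presented_group)
  let ?gen = "generate (presented_group R) (range (pres_gen R))"
  show "?gen \<subseteq> carrier (presented_group R)"
    by (intro generate_incl) auto
  have "pres_rel R `` {u} \<in> ?gen" for u
  proof (induction u)
    case Nil
    then show ?case by (metis generate.one pres_one_class)
  next
    case (Cons l u)
    obtain x s where l: "l = (x, s)" by force
    have "pres_rel R `` {[l]} \<in> ?gen"
    proof (cases s)
      case True
      then show ?thesis using generate.incl[of "pres_gen R x" "range (pres_gen R)"]
        by (simp add: l pres_gen_def)
    next
      case False
      then show ?thesis
        using generate.inv[of "pres_gen R x" "range (pres_gen R)" "presented_group R"]
        by (simp add: l pres_inv_gen)
    qed
    from generate.eng[OF this Cons] show ?case by (simp add: pres_mult_class)
  qed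
  then show "carrier (presented_group R) \<subseteq> ?gen" by (auto elim!: pres_carrierE)
qed

section \<open>The dicyclic groups\<close>

datatype dic_gen = Gen_a | Gen_b | Gen_c

definition dic_relations :: "nat \<Rightarrow> (dic_gen word \<times> dic_gen word) set" where
  "dic_relations n =
    (let a = (Gen_a, True); b = (Gen_b, True); c = (Gen_c, True)
     in {(replicate n a, [b, b]), ([b, b], [c, c]), ([c, c], [a, b, c])})"

definition Dic :: "nat \<Rightarrow> dic_gen word set monoid" where
  "Dic n = presented_group (dic_relations n)"

definition dic :: "nat \<Rightarrow> dic_gen \<Rightarrow> dic_gen word set" where
  "dic n x = pres_gen (dic_relations n) x"

section \<open>The game RAV\<close>

datatype player = Player1 | Player2

text \<open>A history is the list of the elements \<open>s\<^sub>1, \<dots>, s\<^sub>m\<close> chosen so far.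
  It determines the words \<open>w\<^sub>0, \<dots>, w\<^sub>m\<close> as its prefixes.\<close>

locale rav_game = group G for G (structure) and S +
  assumes finite_carrier: "finite (carrier G)"
    and generating: "generate G S = carrier G"
    and one_notin: "\<one> \<notin> S"
begin

definition value_of :: "'a list \<Rightarrow> 'a" where
  "value_of ms = foldl (\<otimes>) \<one> ms"

definition to_move :: "'a list \<Rightarrow> player" where
  "to_move ms = (if even (length ms) then Player1 else Player2)"

definition legal_move :: "'a list \<Rightarrow> 'a \<Rightarrow> bool" where
  "legal_move ms s \<longleftrightarrow> s \<in> S \<union> m_inv G ` S \<and> (ms \<noteq> [] \<longrightarrow> s \<noteq> inv (last ms))"

definition revisits :: "'a list \<Rightarrow> bool" where
  "revisits ms \<longleftrightarrow> (\<exists>k<length ms. value_of ms = value_of (take k ms))"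

definition finished :: "'a list \<Rightarrow> bool" where
  "finished ms \<longleftrightarrow> revisits ms \<or> (\<nexists>s. legal_move ms s)"

inductive play :: "'a list \<Rightarrow> bool" where
  start: "play []"
| move: "play ms \<Longrightarrow> \<not> finished ms \<Longrightarrow> legal_move ms s \<Longrightarrow> play (ms @ [s])"

text \<open>Only meaningful for finished plays. The player who made the last move of a nonempty
  history \<open>ms\<close> is \<open>to_move (butlast ms)\<close>.\<close>

definition loser :: "'a list \<Rightarrow> player" where
  "loser ms = (if revisits ms then to_move (butlast ms) else to_move ms)"

definition follows :: "player \<Rightarrow> ('a list \<Rightarrow> 'a) \<Rightarrow> 'a list \<Rightarrow> bool" where
  "follows p \<sigma> ms \<longleftrightarrow>
    (\<forall>k<length ms. to_move (take k ms) = p \<longrightarrow> ms ! k = \<sigma> (take k ms))"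

text \<open>The strategy must prescribe a legal move whenever it is called upon. Infinite plays need not
  be considered: the carrier is finite, so plays have bounded length (see \<open>play_length_le\<close>).\<close>

definition winning_strategy :: "player \<Rightarrow> ('a list \<Rightarrow> 'a) \<Rightarrow> bool" where
  "winning_strategy p \<sigma> \<longleftrightarrow>
    (\<forall>ms. play ms \<and> follows p \<sigma> ms \<longrightarrow>
      (if finished ms then loser ms \<noteq> p
       else to_move ms = p \<longrightarrow> legal_move ms (\<sigma> ms)))"

definition has_winning_strategy :: "player \<Rightarrow> bool" where
  "has_winning_strategy p \<longleftrightarrow> (\<exists>\<sigma>. winning_strategy p \<sigma>)"

lemma generators_closed: "S \<subseteq> carrier G"
  unfolding generating[symmetric] by (auto intro: generate.incl)

lemma play_moves_closed: "play ms \<Longrightarrow> set ms \<subseteq> carrier G"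
  by (induction rule: play.induct) (use generators_closed in \<open>auto simp: legal_move_def\<close>)

lemma value_of_closed: "set ms \<subseteq> carrier G \<Longrightarrow> value_of ms \<in> carrier G"
  by (induction ms rule: rev_induct) (auto simp: value_of_def)

lemma play_inj:
  "play ms \<Longrightarrow> inj_on (\<lambda>k. value_of (take k ms)) {..<length ms}"
proof (induction rule: play.induct)
  case (move ms s)
  have 1: "value_of ms \<noteq> value_of (take k ms)" if "k < length ms" for k
    using move.hyps(2) that by (auto simp: finished_def revisits_def)
  have 2: "inj_on (\<lambda>k. value_of (take k (ms @ [s]))) {..<length ms}"
    using move.IH by (rule inj_on_cong[THEN iffD1, rotated]) auto
  show ?case
    using 1 2 by (auto simp: lessThan_Suc)
qed auto

lemma play_length_le:
  assumes "play ms"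
  shows "length ms \<le> order G"
proof -
  have "(\<lambda>k. value_of (take k ms)) ` {..<length ms} \<subseteq> carrier G"
    using play_moves_closed[OF assms] by (auto intro!: value_of_closed dest: in_set_takeD)
  from card_inj_on_le[OF play_inj[OF assms] this finite_carrier] show ?thesis
    by (simp add: order_def)
qed

end

section \<open>The dicyclic game is an instance\<close>

text \<open>Right multiplication in the normal form \<open>a\<^sup>i b\<^sup>j\<close>: a letter adds to \<open>i\<close> an amount depending
  on \<open>j\<close> (encoded as a Boolean) and possibly toggles \<open>j\<close>.\<close>

fun dic_flip :: "dic_gen \<Rightarrow> bool" where
  "dic_flip Gen_a = False" | "dic_flip _ = True"

fun dic_shift :: "nat \<Rightarrow> bool \<Rightarrow> dic_gen \<times> bool \<Rightarrow> int" where
  "dic_shift n j (Gen_a, s) = (if j = s then - 1 else 1)"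
| "dic_shift n j (Gen_b, s) = (if s then (if j then int n else 0) else (if j then 0 else - int n))"
| "dic_shift n j (Gen_c, s) =
     (if s then (if j then int n - 1 else 1) else (if j then - 1 else 1 - int n))"

fun dic_act :: "nat \<Rightarrow> dic_gen word \<Rightarrow> int \<times> bool \<Rightarrow> int \<times> bool" where
  "dic_act n [] p = p"
| "dic_act n (l # u) (i, j) = dic_act n u (i + dic_shift n j l, j \<noteq> dic_flip (fst l))"

definition dic_same :: "nat \<Rightarrow> int \<times> bool \<Rightarrow> int \<times> bool \<Rightarrow> bool" where
  "dic_same n p q \<longleftrightarrow> 2 * int n dvd fst p - fst q \<and> snd p = snd q"

lemma dic_act_append: "dic_act n (u @ v) p = dic_act n v (dic_act n u p)"
  by (induction n u p rule: dic_act.induct) auto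

lemma dic_act_shift:
  "dic_act n u (i + d, j) = (fst (dic_act n u (i, j)) + d, snd (dic_act n u (i, j)))"
proof (induction u arbitrary: i j)
  case (Cons l u)
  have "i + d + dic_shift n j l = i + dic_shift n j l + d" by simp
  then show ?case using Cons[of "i + dic_shift n j l"] by (simp only: dic_act.simps)
qed auto

lemma dic_same_trans: "dic_same n p q \<Longrightarrow> dic_same n q r \<Longrightarrow> dic_same n p r"
  using dvd_add[of "2 * int n" "fst p - fst q" "fst q - fst r"] by (simp add: dic_same_def)

lemma dic_same_act:
  assumes "dic_same n p q"
  shows "dic_same n (dic_act n u p) (dic_act n u q)"
proof -
  obtain i j where q: "q = (i, j)" by force
  define d where "d = fst p - i"
  have p: "p = (i + d, j)" and d: "2 * int n dvd d"
    using assms q by (auto simp: dic_same_def d_def prod_eq_iff)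
  show ?thesis unfolding p q dic_act_shift using d by (simp add: dic_same_def)
qed

lemma dic_act_replicate_a:
  "dic_act n (replicate m (Gen_a, True)) (i, j) = (if j then i - int m else i + int m, j)"
  by (induction m arbitrary: i) auto

lemma pres_eq_dic_act:
  "pres_eq (dic_relations n) u v \<Longrightarrow> dic_same n (dic_act n u p) (dic_act n v p)"
proof (induction arbitrary: p rule: pres_eq.induct)
  case (sym u v)
  then show ?case by (auto simp: dic_same_def dvd_diff_commute)
next
  case (trans u v w)
  then show ?case using dic_same_trans by blast
next
  case (append u u' v v')
  then show ?case using dic_same_trans dic_same_act by (metis dic_act_append)
next
  case (cancel x s)
  then show ?case by (cases p; cases x; cases s) (auto simp: dic_same_def)
next
  case (rel u v)
  then show ?case
    by (cases p; cases "snd p")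
      (auto simp: dic_relations_def Let_def dic_same_def dic_act_replicate_a)
qed (auto simp: dic_same_def)

lemma dic_class_act:
  assumes "pres_rel (dic_relations n) `` {u} = pres_rel (dic_relations n) `` {v}"
  shows "dic_same n (dic_act n u (0, False)) (dic_act n v (0, False))"
  using assms pres_eq_dic_act by (simp add: pres_class_eq_iff)

lemma group_Dic: "group (Dic n)"
  by (simp add: Dic_def group_presented_group)

lemma dic_closed [simp]: "dic n x \<in> carrier (Dic n)"
  by (simp add: Dic_def dic_def)

lemma range_dic: "range (dic n) = {dic n Gen_a, dic n Gen_b, dic n Gen_c}"
proof -
  have "(UNIV :: dic_gen set) = {Gen_a, Gen_b, Gen_c}"
    using dic_gen.exhaust by auto
  from arg_cong[OF this, of "image (dic n)"] show ?thesis by simp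
qed

lemma generate_Dic: "generate (Dic n) {dic n Gen_a, dic n Gen_b, dic n Gen_c} = carrier (Dic n)"
  using generate_presented_group[of "dic_relations n"]
  by (simp add: Dic_def flip: range_dic) (simp add: dic_def)

lemma dic_pow: "dic n x [^]\<^bsub>Dic n\<^esub> (m::nat) = pres_rel (dic_relations n) `` {replicate m (x, True)}"
proof (induction m)
  case 0
  then show ?case by (simp add: Dic_def pres_one_class)
next
  case (Suc m)
  have "pres_rel (dic_relations n) `` {replicate m (x, True)} \<otimes>\<^bsub>Dic n\<^esub> dic n x =
    pres_rel (dic_relations n) `` {replicate (Suc m) (x, True)}"
    by (simp add: Dic_def dic_def pres_gen_def pres_mult_class replicate_append_same)
  then show ?case using Suc by simp
qed

lemma Dic_relations:
  fixes n :: nat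
  defines "G \<equiv> Dic n" and "a \<equiv> dic n Gen_a" and "b \<equiv> dic n Gen_b" and "c \<equiv> dic n Gen_c"
  shows "a [^]\<^bsub>G\<^esub> n = b \<otimes>\<^bsub>G\<^esub> b" "b \<otimes>\<^bsub>G\<^esub> b = c \<otimes>\<^bsub>G\<^esub> c"
    "c \<otimes>\<^bsub>G\<^esub> c = a \<otimes>\<^bsub>G\<^esub> b \<otimes>\<^bsub>G\<^esub> c"
  unfolding G_def a_def b_def c_def dic_pow
  by (auto simp: Dic_def dic_def pres_gen_def pres_mult_class pres_class_eq_iff dic_relations_def Let_def
      intro!: pres_eq.rel)

lemma (in group) dic_normal_form:
  fixes n :: nat
  assumes a: "a \<in> carrier G" and b: "b \<in> carrier G" and c: "c \<in> carrier G"
    and r: "a [^] n = b \<otimes> b" "b \<otimes> b = c \<otimes> c" "c \<otimes> c = a \<otimes> b \<otimes> c"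
    and n: "n > 0"
  shows "generate G {a, b, c} \<subseteq> (\<lambda>(i, j). a [^] i \<otimes> b [^] j) ` ({..<2 * n} \<times> {..<2::nat})"
    (is "_ \<subseteq> ?N")
proof -
  have c_eq: "c = a \<otimes> b" using r(3) a b c by (metis m_closed right_cancel)
  have aba: "a \<otimes> (b \<otimes> a) = b"
  proof -
    have "(a \<otimes> (b \<otimes> a)) \<otimes> b = b \<otimes> b"
      using r(2) a b unfolding c_eq by (simp add: m_assoc)
    then show ?thesis using a b by simp
  qed
  have ba: "b \<otimes> a = inv a \<otimes> b"
    using aba a b by (metis inv_solve_left m_closed)
  have apow: "a [^] i \<otimes> (b \<otimes> a [^] i) = b" for i :: nat
  proof (induction i)
    case (Suc i)
    have "a [^] Suc i \<otimes> (b \<otimes> a [^] Suc i) = a \<otimes> (a [^] i \<otimes> (b \<otimes> a [^] i)) \<otimes> a"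
      using a b by (simp add: m_assoc nat_pow_Suc2 del: nat_pow_Suc)
        (metis a b m_assoc m_closed nat_pow_Suc nat_pow_Suc2 nat_pow_closed)
    then show ?case using Suc aba a b by (simp add: m_assoc)
  qed (use b in simp)
  have a2n: "a [^] (2 * n) = \<one>"
  proof -
    have "a [^] n \<otimes> (b \<otimes> a [^] n) = a [^] n \<otimes> (a [^] n \<otimes> b)"
      using a b unfolding r(1) by (simp add: m_assoc)
    also have "\<dots> = a [^] (2 * n) \<otimes> b"
      using a b by (simp add: m_assoc[symmetric] nat_pow_mult mult_2)
    finally have "\<one> \<otimes> b = a [^] (2 * n) \<otimes> b" using apow[of n] b by simp
    then show ?thesis using a b by (metis nat_pow_closed one_closed right_cancel)
  qed
  have red: "a [^] i \<otimes> b [^] j \<in> ?N" if "j < 2" for i j :: nat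
  proof -
    have "a [^] i = a [^] (2 * n * (i div (2 * n)) + i mod (2 * n))" by simp
    also have "\<dots> = a [^] (i mod (2 * n))"
      using a a2n by (simp only: nat_pow_mult[symmetric] nat_pow_pow[symmetric]) simp
    finally show ?thesis using that n by (auto intro!: rev_image_eqI[of "(i mod (2 * n), j)"])
  qed
  have ab2: "a [^] i \<otimes> (b \<otimes> b) = a [^] (i + n)" for i :: nat
    using r(1) a by (metis nat_pow_mult)
  have rb: "x \<otimes> b \<in> ?N" if x: "x \<in> ?N" for x
  proof -
    obtain i j :: nat where j: "j < 2" and x: "x = a [^] i \<otimes> b [^] j" using x by auto
    consider "j = 0" | "j = 1" using j by linarith
    then show ?thesis
    proof cases
      case 1 then show ?thesis using red[of 1 i] a b x by simp
    next
      case 2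
      then have "x \<otimes> b = a [^] (i + n) \<otimes> b [^] (0::nat)" using a b x ab2[of i] by (simp add: m_assoc)
      then show ?thesis using red[of 0 "i + n"] by simp
    qed
  qed
  have ia: "inv a = a [^] (2 * n - 1)"
  proof -
    have "a [^] (2 * n - 1) \<otimes> a = a [^] (2 * n)"
      using n by (metis Suc_diff_1 nat_0_less_mult_iff nat_pow_Suc zero_less_numeral)
    then show ?thesis using a a2n by (metis inv_equality nat_pow_closed)
  qed
  have ra: "x \<otimes> a \<in> ?N" if x: "x \<in> ?N" for x
  proof -
    obtain i j :: nat where j: "j < 2" and x: "x = a [^] i \<otimes> b [^] j" using x by auto
    consider "j = 0" | "j = 1" using j by linarith
    then show ?thesis
    proof cases
      case 1 then show ?thesis using red[of 0 "Suc i"] a b x by simp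
    next
      case 2
      then have "x \<otimes> a = a [^] i \<otimes> (b \<otimes> a)" using a b x by (simp add: m_assoc)
      also have "\<dots> = a [^] (i + (2 * n - 1)) \<otimes> b [^] (1::nat)"
        using a b by (simp add: ba ia m_assoc[symmetric] nat_pow_mult)
      finally show ?thesis using red[of 1 "i + (2 * n - 1)"] by simp
    qed
  qed
  have N_sub: "?N \<subseteq> carrier G" using a b by auto
  have rapow: "x \<otimes> a [^] m \<in> ?N" if x: "x \<in> ?N" for x and m :: nat
  proof (induction m)
    case 0 then show ?case using x N_sub by (simp add: subset_iff)
  next
    case (Suc m)
    then show ?case using ra[OF Suc] x N_sub a by (simp add: m_assoc subset_iff)
  qed
  have rbpow: "x \<otimes> b [^] m \<in> ?N" if x: "x \<in> ?N" for x and m :: nat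
  proof (induction m)
    case 0 then show ?case using x N_sub by (simp add: subset_iff)
  next
    case (Suc m)
    have "x \<in> carrier G" using x N_sub by blast
    then show ?case using rb[OF Suc] b by (simp add: m_assoc)
  qed
  have mult: "x \<otimes> y \<in> ?N" if "x \<in> ?N" "y \<in> ?N" for x y
  proof -
    obtain i j :: nat where y: "y = a [^] i \<otimes> b [^] j" using \<open>y \<in> ?N\<close> by auto
    have "x \<in> carrier G" using that N_sub by blast
    then have "x \<otimes> y = x \<otimes> a [^] i \<otimes> b [^] j" using a b y by (simp add: m_assoc)
    then show ?thesis using rbpow[OF rapow[OF \<open>x \<in> ?N\<close>]] by simp
  qed
  have one_N: "\<one> \<in> ?N" using red[of 0 0] a b by simp
  have aN: "a \<in> ?N" and bN: "b \<in> ?N" using ra[OF one_N] rb[OF one_N] a b by simp_all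
  have cN: "c \<in> ?N" using mult[OF aN bN] c_eq by simp
  have powN: "x [^] m \<in> ?N" if "x \<in> ?N" for x and m :: nat
    by (induction m) (use one_N mult that in simp_all)
  have fin: "finite ?N" by simp
  have inv_N: "inv x \<in> ?N" if x: "x \<in> ?N" for x
  proof -
    have xc: "x \<in> carrier G" using x N_sub by blast
    have "\<not> inj (\<lambda>m::nat. x [^] m)"
      using powN[OF x] fin by (metis finite_imageD finite_subset image_subsetI infinite_UNIV_nat)
    then obtain k l :: nat where "k < l" and kl: "x [^] k = x [^] l"
      by (metis injI linorder_neqE_nat)
    then obtain m where l: "l = Suc m + k" by (metis add.commute less_imp_Suc_add add_Suc)
    have "x [^] Suc m \<otimes> x [^] k = \<one> \<otimes> x [^] k"
      using xc kl[symmetric] unfolding l by (simp only: nat_pow_mult l_one nat_pow_closed)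
    then have "x [^] Suc m = \<one>" using xc by (metis nat_pow_closed one_closed right_cancel)
    then have "inv x = x [^] m" using xc by (intro inv_equality) simp_all
    then show ?thesis using powN[OF x] by simp
  qed
  show ?thesis
  proof
    fix x assume "x \<in> generate G {a, b, c}"
    then show "x \<in> ?N"
    proof (induction rule: generate.induct)
      case one then show ?case by (rule one_N)
    next
      case (incl h) then show ?case using aN bN cN by blast
    next
      case (inv h) then show ?case using inv_N aN bN cN by blast
    next
      case (eng h1 h2) then show ?case using mult by blast
    qed
  qed
qed

lemma order_Dic:
  assumes "n > 0"
  shows "order (Dic n) = 4 * n" and finite_Dic: "finite (carrier (Dic n))"
proof -
  interpret group "Dic n" by (rule group_Dic)
  let ?a = "dic n Gen_a" and ?b = "dic n Gen_b"
  let ?f = "\<lambda>(i::nat, j::nat). ?a [^]\<^bsub>Dic n\<^esub> i \<otimes>\<^bsub>Dic n\<^esub> ?b [^]\<^bsub>Dic n\<^esub> j"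
  let ?D = "{..<2 * n} \<times> {..<2::nat}"
  have sub: "carrier (Dic n) \<subseteq> ?f ` ?D"
    using dic_normal_form[OF _ _ _ Dic_relations assms] by (simp add: generate_Dic)
  have eq: "carrier (Dic n) = ?f ` ?D"
    using sub by auto
  have inj: "inj_on ?f ?D"
  proof (rule inj_onI, clarify)
    fix i j i' j' :: nat
    assume ij: "i < 2 * n" "j < 2" "i' < 2 * n" "j' < 2"
      and "?a [^]\<^bsub>Dic n\<^esub> i \<otimes>\<^bsub>Dic n\<^esub> ?b [^]\<^bsub>Dic n\<^esub> j = ?a [^]\<^bsub>Dic n\<^esub> i' \<otimes>\<^bsub>Dic n\<^esub> ?b [^]\<^bsub>Dic n\<^esub> j'"
    then have *: "dic_same n
        (dic_act n (replicate i (Gen_a, True) @ replicate j (Gen_b, True)) (0, False))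
        (dic_act n (replicate i' (Gen_a, True) @ replicate j' (Gen_b, True)) (0, False))"
      unfolding dic_pow by (intro dic_class_act) (simp add: Dic_def pres_mult_class)
    have "j = 0 \<or> j = 1" "j' = 0 \<or> j' = 1" using ij by linarith+
    with * have jj: "j = j'" and d: "2 * int n dvd int i - int i'"
      by (auto simp: dic_act_append dic_act_replicate_a dic_same_def)
    have "\<bar>int i - int i'\<bar> < 2 * int n" using ij by linarith
    with d have "i = i'" using zdvd_not_zless
      by (metis abs_of_nat dvd_imp_le_int not_less of_nat_eq_iff right_minus_eq abs_mult abs_numeral)
    with jj show "i = i' \<and> j = j'" by simp
  qed
  show "order (Dic n) = 4 * n" using inj unfolding order_def eq by (simp add: card_image)
  show "finite (carrier (Dic n))" unfolding eq by simp
qed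

lemma rav_game_Dic:
  assumes "n > 0"
  shows "rav_game (Dic n) {dic n Gen_a, dic n Gen_b, dic n Gen_c}"
proof -
  have "dic n x \<noteq> \<one>\<^bsub>Dic n\<^esub>" for x
  proof
    assume "dic n x = \<one>\<^bsub>Dic n\<^esub>"
    then have "dic_same n (dic_act n [(x, True)] (0, False)) (dic_act n [] (0, False))"
      by (intro dic_class_act) (simp add: Dic_def dic_def pres_gen_def pres_one_class)
    moreover have "\<not> 2 * int n dvd 1" by (metis dvd_mult_left odd_one)
    ultimately show False by (cases x) (auto simp: dic_same_def)
  qed
  then have "\<one>\<^bsub>Dic n\<^esub> \<notin> {dic n Gen_a, dic n Gen_b, dic n Gen_c}"
    by (metis empty_iff insertE)
  then show ?thesis
    using finite_Dic[OF assms] generate_Dic group_Dic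
    by (simp add: rav_game_def rav_game_axioms_def)
qed

end

theory Submission imports Defs begin

text \<open>RAV is a game of vertex geography on a Cayley graph, so a perfect matching of the graph wins it
  for Player 1, who always moves to the partner of the current vertex: after each such move
  the visited vertices form a union of matched pairs. In \<open>Dic\<^sub>n\<close> the parity of the number of
  letters \<open>b\<^sup>\<plusminus>\<^sup>1\<close>, \<open>c\<^sup>\<plusminus>\<^sup>1\<close> is well defined, and the edges \<open>{g, g b}\<close> with \<open>g\<close> of even
  parity form a perfect matching.\<close>

context rav_game
begin

lemma value_of_snoc: "value_of (ms @ [s]) = value_of ms \<otimes> s"
  by (simp add: value_of_def)

lemma value_of_take_Suc:
  "k < length ms \<Longrightarrow> value_of (take (Suc k) ms) = value_of (take k ms) \<otimes> ms ! k"
  by (simp add: take_Suc_conv_app_nth value_of_snoc)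

text \<open>\<open>m g\<close> is the letter on the matching edge at \<open>g\<close>. By
  \<open>partner\<close>, the map \<open>g \<mapsto> g \<otimes> m g\<close> is an involution; it
  has no fixed point because \<open>\<one> \<notin> S\<close>.\<close>

theorem has_winning_strategy_Player1_matching:
  fixes m :: "'a \<Rightarrow> 'a"
  assumes edge: "\<And>g. g \<in> carrier G \<Longrightarrow> m g \<in> S \<union> m_inv G ` S"
    and partner: "\<And>g. g \<in> carrier G \<Longrightarrow> m (g \<otimes> m g) = inv (m g)"
  shows "has_winning_strategy Player1"
proof -
  define f where "f g = g \<otimes> m g" for g
  define \<sigma> where "\<sigma> ms = m (value_of ms)" for ms
  have m_closed': "m g \<in> carrier G" if "g \<in> carrier G" for g
    using edge[OF that] generators_closed by auto
  have m_ne: "m g \<noteq> \<one>" if "g \<in> carrier G" for g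
    using edge[OF that] one_notin generators_closed inv_eq_1_iff by (metis UnE imageE subsetD)
  have ff: "f (f g) = g" if "g \<in> carrier G" for g
    using partner[OF that] m_closed'[OF that] that by (simp add: f_def m_assoc)
  have f_ne: "f g \<noteq> g" if "g \<in> carrier G" for g
    using m_ne[OF that] m_closed'[OF that] that by (simp add: f_def)
  have "if finished ms then loser ms \<noteq> Player1
      else to_move ms = Player1 \<longrightarrow> legal_move ms (\<sigma> ms)"
    if play: "play ms" and follows: "follows Player1 \<sigma> ms" for ms
  proof -
    define v where "v k = value_of (take k ms)" for k
    have v_closed: "v k \<in> carrier G" for k
      unfolding v_def using play_moves_closed[OF play] by (auto intro!: value_of_closed dest: in_set_takeD)
    have v_even: "v (Suc k) = f (v k)" if "k < length ms" "even k" for k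
      using follows that by (simp add: follows_def to_move_def v_def value_of_take_Suc f_def \<sigma>_def)
    \<comment> \<open>Both indices stay below \<open>length ms\<close>: the last vertex of a play
      may be a revisit.\<close>
    have inj: "j = k" if "v j = v k" "j < length ms" "k < length ms" for j k
      using play_inj[OF play] that by (simp add: inj_on_def v_def)
    have value_ms: "value_of ms = v (length ms)" by (simp add: v_def)
    show ?thesis
    proof (cases "even (length ms)")
      case True
      have "legal_move ms (\<sigma> ms)" if "\<not> revisits ms"
      proof -
        have "\<sigma> ms \<noteq> inv (last ms)" if "ms \<noteq> []"
        proof
          assume eq: "\<sigma> ms = inv (last ms)"
          \<comment> \<open>\<open>v k\<close> and \<open>v (Suc k)\<close> are the pair completed
            by the previous move of Player 1. If the reply undid the move of Player 2 that followed,
            the current vertex would have the same partner as \<open>v k\<close>, hence equal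
            \<open>v k\<close>: a revisit.\<close>
          obtain k where len: "length ms = Suc (Suc k)" and "even k"
            using True \<open>ms \<noteq> []\<close> by (cases ms rule: rev_cases; cases "butlast ms" rule: rev_cases) auto
          have "last ms \<in> carrier G"
            using play_moves_closed[OF play] \<open>ms \<noteq> []\<close> last_in_set by blast
          moreover have "value_of ms = v (Suc k) \<otimes> last ms"
            using value_of_take_Suc[of "Suc k" ms] len \<open>ms \<noteq> []\<close> by (simp add: v_def last_conv_nth)
          ultimately have "f (value_of ms) = v (Suc k)"
            using eq v_closed by (simp add: f_def \<sigma>_def m_assoc)
          also have "\<dots> = f (v k)" using v_even len \<open>even k\<close> by simp
          finally have "value_of ms = v k" using ff v_closed value_ms by metis
          then show False
            using \<open>\<not> revisits ms\<close> len unfolding revisits_def v_def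
            by (metis lessI less_SucI)
        qed
        then show ?thesis using edge v_closed by (simp add: legal_move_def \<sigma>_def value_ms)
      qed
      \<comment> \<open>A word of positive even length was formed by Player 2.\<close>
      moreover have "loser ms \<noteq> Player1" if "revisits ms"
        using that True by (auto simp: loser_def to_move_def revisits_def)
      ultimately show ?thesis by (auto simp: finished_def)
    next
      case False
      then obtain l where len: "length ms = Suc l" and "even l"
        by (cases "length ms") auto
      have "\<not> revisits ms"
      proof
        assume "revisits ms"
        then obtain k where "k < length ms" and "v (Suc l) = v k"
          unfolding revisits_def value_ms len v_def by blast
        then have k: "k \<le> l" using len by simp
        have vk: "v k = f (v l)"
          using \<open>v (Suc l) = v k\<close> v_even len \<open>even l\<close> by simp
        then have "k < l" using f_ne v_closed k by (metis le_neq_implies_less)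
        \<comment> \<open>So the vertex that Player 1 moved from is the partner of
          \<open>v k\<close>. That partner was visited right after \<open>v k\<close> if
          \<open>k\<close> is even and right before it if \<open>k\<close> is odd.\<close>
        have vl: "v l = f (v k)" using vk ff v_closed by simp
        show False
        proof (cases "even k")
          case True
          then have "v (Suc k) = v l" using vl v_even \<open>k < l\<close> len by simp
          \<comment> \<open>\<open>Suc k\<close> is odd and \<open>l\<close> is even, so the indices
            differ.\<close>
          then show False using inj[of "Suc k" l] \<open>k < l\<close> len True \<open>even l\<close> by auto
        next
          case False
          then obtain j where j: "k = Suc j" "even j" by (cases k) auto
          then have "v l = v j" using vl v_even \<open>k < l\<close> len ff v_closed by simp
          then show False using inj[of l j] \<open>k < l\<close> len j by auto
        qed
      qed
      \<comment> \<open>Without a revisit, a finished play is lost by the player to move, here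
        Player 2.\<close>
      then show ?thesis using False by (simp add: loser_def to_move_def)
    qed
  qed
  then show ?thesis unfolding has_winning_strategy_def winning_strategy_def by blast
qed

text \<open>Right multiplication by \<open>s\<close> splits the group into cycles, and
  \<open>P\<close> alternates along each of them. Taking every second edge gives a matching:
  \<open>s\<close> leads out of the vertices where \<open>P\<close> fails, and \<open>inv s\<close>
  leads back.\<close>

corollary has_winning_strategy_Player1_parity:
  assumes s: "s \<in> S" and parity: "\<And>g. g \<in> carrier G \<Longrightarrow> P (g \<otimes> s) \<longleftrightarrow> \<not> P g"
  shows "has_winning_strategy Player1"
proof (rule has_winning_strategy_Player1_matching)
  fix g assume g: "g \<in> carrier G"
  have sc: "s \<in> carrier G" using s generators_closed by blast
  have "P (g \<otimes> inv s) \<longleftrightarrow> \<not> P g"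
    using parity[of "g \<otimes> inv s"] g sc by (simp add: m_assoc)
  then show "(if P (g \<otimes> (if P g then inv s else s)) then inv s else s)
      = inv (if P g then inv s else s)"
    using parity[OF g] sc by simp
qed (use s in simp)

end

text \<open>This is the homomorphism onto Z/2 that kills \<open>a\<close> and is nontrivial on
  \<open>b\<close> and \<open>c\<close>. Any representative may serve as the witness.\<close>

definition dic_parity :: "nat \<Rightarrow> dic_gen word set \<Rightarrow> bool" where
  "dic_parity n A \<longleftrightarrow> (\<exists>u\<in>A. snd (dic_act n u (0, False)))"

text \<open>Equal words act alike by \<open>pres_eq_dic_act\<close>, so the choice of representative
  is immaterial.\<close>

lemma dic_parity_class:
  "dic_parity n (pres_rel (dic_relations n) `` {u}) \<longleftrightarrow> snd (dic_act n u (0, False))"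
  using pres_eq_dic_act[of n u _ "(0, False)"]
  by (auto simp: dic_parity_def pres_rel_def dic_same_def intro: pres_eq.refl)

lemma dic_parity_mult_b:
  assumes "g \<in> carrier (Dic n)"
  shows "dic_parity n (g \<otimes>\<^bsub>Dic n\<^esub> dic n Gen_b) \<longleftrightarrow> \<not> dic_parity n g"
proof -
  obtain u where g: "g = pres_rel (dic_relations n) `` {u}"
    using assms by (auto simp: Dic_def elim: pres_carrierE)
  show ?thesis
    by (cases "dic_act n u (0, False)")
      (simp add: g Dic_def dic_def pres_gen_def pres_mult_class dic_parity_class dic_act_append)
qed

theorem theorem4p2:
  fixes n :: nat
  assumes "n \<ge> 2"
  shows "rav_game.has_winning_strategy (Dic n) {dic n Gen_a, dic n Gen_b, dic n Gen_c} Player1"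
proof -
  interpret rav_game "Dic n" "{dic n Gen_a, dic n Gen_b, dic n Gen_c}"
    using rav_game_Dic assms by simp
  show ?thesis
    by (rule has_winning_strategy_Player1_parity[where s = "dic n Gen_b" and P = "dic_parity n"])
      (simp_all add: dic_parity_mult_b)
qed

end
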